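(* A directed graph $G$ (all of whose edges are arrows) is an AMP essential graph iff it is acyclic and each arrow of $G$ is protected in $G$, that is, each arrow $a\to b\in G$ occurs in at least one of the following configurations as an induced subgraph of $G$: (i) $c\to a\to b$ with $c,b$ nonadjacent; (ii) $a\to b\leftarrow c$ with $a,c$ nonadjacent; (iii) $a\to b$, $a\to c$, $c\to b$. Thus, the class of directed AMP essential graphs coincides with the class of directed ADG essential graphs.
   Context: All graphs are finite; between two distinct vertices there is at most one edge, which is either a line $a-b$ or an arrow $a\to b$. $a\Rightarrow b$ means $a\to b$ or $a-b$. A $k$-cycle ($k\ge 3$) is a sequence $(v_0,\dots,v_k=v_0)$, with $v_0,\dots,v_{k-1}$ distinct, such that $v_{i-1}\Rightarrow v_i$ for all $i$; it is semi-directed if at least one of these edges is an arrow. A chain graph (CG) is an adicyclic graph, i.e., one with no semi-directed cycles. An ADG is an acyclic directed graph. The skeleton is the graph obtained by forgetting orientations. A triplex $(\{a,c\},b)$ occurs in a graph if $a,c$ are nonadjacent and the induced subgraph on $\{a,b,c\}$ is $a\to b\leftarrow c$ (an immorality), or $a\to b-c$ or $a-b\leftarrow c$ (flags). Two CGs on the same vertex set are AMP Markov equivalent if they determine the same set of distributions under the AMP Markov property; by a known theorem this holds iff they have the same skeleton and the same triplexes, which may be taken as the definition. For an AMP Markov equivalence class $\mathcal{G}$ of CGs, the AMP essential graph $\mathcal{G}^*$ has the common skeleton of the members of $\mathcal{G}$; an arrow $a\to b$ occurs in $\mathcal{G}^*$ iff $a\to b\in G$ for at least one $G\in\mathcal{G}$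 but $a\leftarrow b\in G'$ for no $G'\in\mathcal{G}$; every other edge of the skeleton is a line in $\mathcal{G}^*$. A graph is an AMP essential graph if it equals $\mathcal{G}^*$ for some such $\mathcal{G}$. Two ADGs on the same vertex set are Markov equivalent iff they have the same skeleton and the same immoralities. For a Markov equivalence class $\mathcal{D}$ of ADGs, the ADG essential graph $\mathcal{D}^*=\bigcup\{D\mid D\in\mathcal{D}\}$ has the common skeleton, with $a\to b\in\mathcal{D}^*$ iff $a\to b\in D$ for all $D\in\mathcal{D}$, and with $a-b\in\mathcal{D}^*$ iff $a\to b$ and $a\leftarrow b$ occur in two different members of $\mathcal{D}$. *)

theory Defs
  imports Main
begin

text \<open>
  A mixed graph is encoded by its vertex set and the relation \<open>a \<Rightarrow> b\<close>, "there is an arrow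
  from a to b or a line between a and b". A line is thus a pair of mutually inverse ordered
  pairs, so that between two vertices there is at most one edge, and the union of graphs is the
  union of vertex sets and of edge relations (two opposite arrows unite to a line).
\<close>

record 'a mgraph =
  verts :: "'a set"
  edges :: "('a \<times> 'a) set"

definition mgraph :: "'a mgraph \<Rightarrow> bool" where
  "mgraph G \<longleftrightarrow> finite (verts G) \<and> edges G \<subseteq> verts G \<times> verts G \<and> irrefl (edges G)"

definition arrow :: "'a mgraph \<Rightarrow> 'a \<Rightarrow> 'a \<Rightarrow> bool" where
  "arrow G a b \<longleftrightarrow> (a, b) \<in> edges G \<and> (b, a) \<notin> edges G"

definition line :: "'a mgraph \<Rightarrow> 'a \<Rightarrow> 'a \<Rightarrow> bool" where
  "line G a b \<longleftrightarrow> (a, b) \<in> edges G \<and> (b, a) \<in> edges G"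

definition nonadjacent :: "'a mgraph \<Rightarrow> 'a \<Rightarrow> 'a \<Rightarrow> bool" where
  "nonadjacent G a b \<longleftrightarrow> a \<noteq> b \<and> (a, b) \<notin> edges G \<and> (b, a) \<notin> edges G"

definition skeleton :: "'a mgraph \<Rightarrow> 'a mgraph" where
  "skeleton G = \<lparr>verts = verts G, edges = edges G \<union> (edges G)\<inverse>\<rparr>"

definition directed_graph :: "'a mgraph \<Rightarrow> bool" where
  "directed_graph G \<longleftrightarrow> mgraph G \<and> (\<forall>a b. \<not> line G a b)"

text \<open>
  The \<open>k\<close>-cycle with vertices \<open>v\<^sub>0, \<dots>, v\<^sub>k = v\<^sub>0\<close> is represented by the list of its \<open>k\<close> distinct
  vertices; hence the index modulo \<open>k\<close>.
\<close>

definition cycle :: "'a mgraph \<Rightarrow> 'a list \<Rightarrow> bool" where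
  "cycle G vs \<longleftrightarrow> length vs \<ge> 3 \<and> distinct vs \<and>
     (\<forall>i < length vs. (vs ! i, vs ! (Suc i mod length vs)) \<in> edges G)"

definition semi_directed_cycle :: "'a mgraph \<Rightarrow> 'a list \<Rightarrow> bool" where
  "semi_directed_cycle G vs \<longleftrightarrow> cycle G vs \<and>
     (\<exists>i < length vs. arrow G (vs ! i) (vs ! (Suc i mod length vs)))"

definition chain_graph :: "'a mgraph \<Rightarrow> bool" where
  "chain_graph G \<longleftrightarrow> mgraph G \<and> (\<nexists>vs. semi_directed_cycle G vs)"

definition acyclic_graph :: "'a mgraph \<Rightarrow> bool" where
  "acyclic_graph G \<longleftrightarrow> (\<nexists>vs. cycle G vs)"

definition ADG :: "'a mgraph \<Rightarrow> bool" where
  "ADG G \<longleftrightarrow> directed_graph G \<and> acyclic_graph G"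


section \<open>AMP essential graphs\<close>

definition triplexes :: "'a mgraph \<Rightarrow> ('a set \<times> 'a) set" where
  "triplexes G = {({a, c}, b) | a b c. nonadjacent G a c \<and>
     (arrow G a b \<and> arrow G c b \<or> arrow G a b \<and> line G b c \<or> line G a b \<and> arrow G c b)}"

text \<open>
  AMP Markov equivalence of chain graphs, taken in its graphical characterization. Equality of
  the skeletons includes equality of the vertex sets.
\<close>

definition AMP_equivalence :: "('a mgraph \<times> 'a mgraph) set" where
  "AMP_equivalence = {(G, H). chain_graph G \<and> chain_graph H \<and>
     skeleton G = skeleton H \<and> triplexes G = triplexes H}"

definition AMP_classes :: "'a mgraph set set" where
  "AMP_classes = {G. chain_graph G} // AMP_equivalence"

definition AMP_arrows :: "'a mgraph set \<Rightarrow> ('a \<times> 'a) set" where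
  "AMP_arrows \<G> = {(a, b). (\<exists>G\<in>\<G>. arrow G a b) \<and> \<not> (\<exists>G'\<in>\<G>. arrow G' b a)}"

text \<open>
  All members of a class have the same skeleton, so the unions below are just the vertex set and
  the edge set of this common skeleton (see \<open>skeleton_AMP_star\<close> below).
\<close>

definition AMP_star :: "'a mgraph set \<Rightarrow> 'a mgraph" where
  "AMP_star \<G> =
     \<lparr>verts = (\<Union>G\<in>\<G>. verts G),
      edges = AMP_arrows \<G> \<union>
        {(a, b). (a, b) \<in> (\<Union>G\<in>\<G>. edges (skeleton G)) \<and>
                 (a, b) \<notin> AMP_arrows \<G> \<and> (b, a) \<notin> AMP_arrows \<G>}\<rparr>"

definition AMP_essential_graph :: "'a mgraph \<Rightarrow> bool" where
  "AMP_essential_graph H \<longleftrightarrow> (\<exists>\<G> \<in> AMP_classes. H = AMP_star \<G>)"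


section \<open>ADG essential graphs\<close>

definition immoralities :: "'a mgraph \<Rightarrow> ('a set \<times> 'a) set" where
  "immoralities G = {({a, c}, b) | a b c. nonadjacent G a c \<and> arrow G a b \<and> arrow G c b}"

definition ADG_equivalence :: "('a mgraph \<times> 'a mgraph) set" where
  "ADG_equivalence = {(D, D'). ADG D \<and> ADG D' \<and>
     skeleton D = skeleton D' \<and> immoralities D = immoralities D'}"

definition ADG_classes :: "'a mgraph set set" where
  "ADG_classes = {D. ADG D} // ADG_equivalence"

definition ADG_star :: "'a mgraph set \<Rightarrow> 'a mgraph" where
  "ADG_star \<D> = \<lparr>verts = (\<Union>D\<in>\<D>. verts D), edges = (\<Union>D\<in>\<D>. edges D)\<rparr>"

definition ADG_essential_graph :: "'a mgraph \<Rightarrow> bool" where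
  "ADG_essential_graph H \<longleftrightarrow> (\<exists>\<D> \<in> ADG_classes. H = ADG_star \<D>)"


section \<open>Protected arrows\<close>

definition protected :: "'a mgraph \<Rightarrow> 'a \<Rightarrow> 'a \<Rightarrow> bool" where
  "protected G a b \<longleftrightarrow>
     (\<exists>c. arrow G c a \<and> arrow G a b \<and> nonadjacent G c b) \<or>
     (\<exists>c. arrow G a b \<and> arrow G c b \<and> nonadjacent G a c) \<or>
     (\<exists>c. arrow G a b \<and> arrow G a c \<and> arrow G c b)"


section \<open>Agreement of the encoding with the arrow-and-line descriptions\<close>

lemma equiv_AMP_equivalence: "equiv {G. chain_graph G} AMP_equivalence"
  unfolding AMP_equivalence_def by (auto intro!: equivI refl_onI symI transI)

lemma equiv_ADG_equivalence: "equiv {D. ADG D} ADG_equivalence"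
  unfolding ADG_equivalence_def by (auto intro!: equivI refl_onI symI transI)

lemma arrow_AMP_star:
  "arrow (AMP_star \<G>) a b \<longleftrightarrow> (\<exists>G\<in>\<G>. arrow G a b) \<and> \<not> (\<exists>G\<in>\<G>. arrow G b a)"
  unfolding AMP_star_def AMP_arrows_def arrow_def skeleton_def by auto

lemma skeleton_eq_iff:
  "skeleton G = skeleton H \<longleftrightarrow> verts G = verts H \<and>
     (\<forall>x y. (x, y) \<in> edges G \<or> (y, x) \<in> edges G \<longleftrightarrow> (x, y) \<in> edges H \<or> (y, x) \<in> edges H)"
  by (simp add: skeleton_def set_eq_iff)

lemma skeleton_AMP_class:
  assumes "\<G> \<in> AMP_classes" and "G \<in> \<G>" and "H \<in> \<G>"
  shows "skeleton G = skeleton H"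
  using assms unfolding AMP_classes_def AMP_equivalence_def by (auto elim!: quotientE)

lemma skeleton_AMP_star:
  assumes "\<G> \<in> AMP_classes" and "G \<in> \<G>"
  shows "skeleton (AMP_star \<G>) = skeleton G"
proof -
  have same: "verts H = verts G"
    "(x, y) \<in> edges H \<or> (y, x) \<in> edges H \<longleftrightarrow> (x, y) \<in> edges G \<or> (y, x) \<in> edges G"
    if "H \<in> \<G>" for H x y
    using skeleton_AMP_class[OF assms(1) that assms(2)] by (simp_all add: skeleton_eq_iff)
  have arr: "(x, y) \<in> edges G \<or> (y, x) \<in> edges G" if xy: "(x, y) \<in> AMP_arrows \<G>" for x y
  proof -
    obtain H where "H \<in> \<G>" "(x, y) \<in> edges H"
      using xy by (auto simp: AMP_arrows_def arrow_def)
    then show ?thesis using same(2)[of H x y] by simp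
  qed
  have un: "(x, y) \<in> (\<Union>H\<in>\<G>. edges (skeleton H)) \<longleftrightarrow> (x, y) \<in> edges G \<or> (y, x) \<in> edges G"
    for x y
  proof -
    have "(x, y) \<in> (\<Union>H\<in>\<G>. edges (skeleton H)) \<longleftrightarrow>
        (\<exists>H\<in>\<G>. (x, y) \<in> edges H \<or> (y, x) \<in> edges H)"
      by (simp add: skeleton_def)
    also have "\<dots> \<longleftrightarrow> (\<exists>H\<in>\<G>. (x, y) \<in> edges G \<or> (y, x) \<in> edges G)"
      by (rule bex_cong[OF refl same(2)])
    finally show ?thesis using assms(2) by blast
  qed
  have mem: "(x, y) \<in> edges (AMP_star \<G>) \<longleftrightarrow> (x, y) \<in> AMP_arrows \<G> \<or>
      (x, y) \<in> (\<Union>H\<in>\<G>. edges (skeleton H)) \<and> (x, y) \<notin> AMP_arrows \<G> \<and> (y, x) \<notin> AMP_arrows \<G>"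
    for x y
    by (simp add: AMP_star_def)
  have "verts (AMP_star \<G>) = (\<Union>H\<in>\<G>. verts H)"
    by (simp add: AMP_star_def)
  also have "\<dots> = (\<Union>H\<in>\<G>. verts G)"
    by (rule SUP_cong[OF refl same(1)])
  also have "\<dots> = verts G"
    using assms(2) by blast
  finally show ?thesis
    unfolding skeleton_eq_iff mem un using arr by blast
qed

lemma ADG_class_facts:
  assumes "\<D> \<in> ADG_classes"
  shows "\<D> \<noteq> {}"
    and "D \<in> \<D> \<Longrightarrow> \<not> line D a b"
    and "D \<in> \<D> \<Longrightarrow> D' \<in> \<D> \<Longrightarrow> skeleton D = skeleton D'"
proof -
  show "\<D> \<noteq> {}"
    using assms in_quotient_imp_non_empty[OF equiv_ADG_equivalence]
    unfolding ADG_classes_def by blast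
  show "\<not> line D a b" if "D \<in> \<D>"
    using assms that unfolding ADG_classes_def ADG_equivalence_def ADG_def directed_graph_def
    by (auto elim!: quotientE)
  show "skeleton D = skeleton D'" if "D \<in> \<D>" "D' \<in> \<D>"
    using assms that unfolding ADG_classes_def ADG_equivalence_def by (auto elim!: quotientE)
qed

lemma ADG_class_edges:
  assumes "\<D> \<in> ADG_classes" "D \<in> \<D>" "D' \<in> \<D>" "(a, b) \<in> edges D"
  shows "(a, b) \<in> edges D' \<and> (b, a) \<notin> edges D' \<or> (a, b) \<notin> edges D' \<and> (b, a) \<in> edges D'"
  using ADG_class_facts(2)[OF assms(1,3), of a b] ADG_class_facts(3)[OF assms(1,2,3)] assms(4)
  unfolding line_def skeleton_eq_iff by blast

lemma skeleton_ADG_star: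
  assumes "\<D> \<in> ADG_classes" and "D \<in> \<D>"
  shows "skeleton (ADG_star \<D>) = skeleton D"
proof -
  have v: "verts H = verts D" if "H \<in> \<D>" for H
    using ADG_class_facts(3)[OF assms(1) that assms(2)] by (simp add: skeleton_eq_iff)
  have "verts (ADG_star \<D>) = (\<Union>H\<in>\<D>. verts H)"
    by (simp add: ADG_star_def)
  also have "\<dots> = (\<Union>H\<in>\<D>. verts D)"
    by (rule SUP_cong[OF refl v])
  also have "\<dots> = verts D"
    using assms(2) by blast
  finally have "verts (ADG_star \<D>) = verts D" .
  moreover have "(x, y) \<in> edges D \<or> (y, x) \<in> edges D" if xy: "(x, y) \<in> edges (ADG_star \<D>)"
    for x y
  proof -
    obtain H where H: "H \<in> \<D>" "(x, y) \<in> edges H"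
      using xy by (auto simp: ADG_star_def)
    then show ?thesis
      using ADG_class_edges[OF assms(1) H(1) assms(2) H(2)] by blast
  qed
  moreover have "edges D \<subseteq> edges (ADG_star \<D>)"
    using assms(2) by (auto simp: ADG_star_def)
  ultimately show ?thesis
    unfolding skeleton_eq_iff by blast
qed

lemma line_ADG_star:
  assumes "\<D> \<in> ADG_classes"
  shows "line (ADG_star \<D>) a b \<longleftrightarrow> (\<exists>D\<in>\<D>. arrow D a b) \<and> (\<exists>D\<in>\<D>. arrow D b a)"
proof -
  have "arrow D x y \<longleftrightarrow> (x, y) \<in> edges D" if "D \<in> \<D>" for D x y
    using ADG_class_facts(2)[OF assms that, of x y] by (auto simp: arrow_def line_def)
  then show ?thesis
    by (simp add: line_def ADG_star_def)
qed

lemma arrow_ADG_star: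
  assumes "\<D> \<in> ADG_classes"
  shows "arrow (ADG_star \<D>) a b \<longleftrightarrow> (\<forall>D\<in>\<D>. arrow D a b)"
proof
  assume l: "arrow (ADG_star \<D>) a b"
  then obtain D where D: "D \<in> \<D>" "(a, b) \<in> edges D"
    by (auto simp: ADG_star_def arrow_def)
  show "\<forall>D\<in>\<D>. arrow D a b"
  proof
    fix H assume H: "H \<in> \<D>"
    then have "(b, a) \<notin> edges H"
      using l by (auto simp: ADG_star_def arrow_def)
    then show "arrow H a b"
      using ADG_class_edges[OF assms D(1) H D(2)] by (simp add: arrow_def)
  qed
next
  assume "\<forall>D\<in>\<D>. arrow D a b"
  then show "arrow (ADG_star \<D>) a b"
    using ADG_class_facts(1)[OF assms] by (auto simp: ADG_star_def arrow_def)
qed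

end

theory Submission
  imports Defs
begin

text \<open>
  Both classes of essential graphs turn out to have the same directed members, namely the ADGs in
  which every arrow is protected, and the argument has two halves.

  Protection prevents reversal. Let \<open>G\<close> be an ADG with all arrows protected, and suppose that a
  chain graph \<open>H\<close> with the same skeleton and the same triplexes contains \<open>b \<rightarrow> a\<close> although \<open>G\<close>
  contains \<open>a \<rightarrow> b\<close>. Configuration (ii) is a triplex at \<open>b\<close> and forbids this outright. In
  configuration (i) the absence of a triplex at \<open>a\<close> forces the arrow \<open>c \<rightarrow> a\<close> to be reversed too, and
  in configuration (iii) the adicyclicity of \<open>H\<close> forces \<open>a \<rightarrow> c\<close> or \<open>c \<rightarrow> b\<close> to be reversed. Each of
  these arrows either has a head that precedes \<open>b\<close> in \<open>G\<close>, or has head \<open>b\<close> and a tail that comes after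
  \<open>a\<close>; so there is no first reversed arrow, and hence none (\<open>protected_not_reversed\<close>). Thus in
  both kinds of classes the essential graph of the class of \<open>G\<close> is \<open>G\<close> itself.

  Unprotected arrows can be reversed. If \<open>a \<rightarrow> b\<close> is not protected in an ADG, then the parents of
  \<open>b\<close> are \<open>a\<close> and the parents of \<open>a\<close>, and turning this single arrow around preserves acyclicity and
  immoralities (\<open>unprotected_reversible\<close>). A directed essential graph that belongs to its own class
  has no such arrow, since an arrow with a reversal in the class would be a line of the essential
  graph. Every directed essential graph does belong to its class. For ADGs this is because all
  members agree with it (\<open>directed_ADG_star\<close>). In the AMP case the
  members may still have lines where \<open>\<G>\<^sup>*\<close> has arrows, but each arrow of \<open>\<G>\<^sup>*\<close> occurs in some member
  and is opposed by none, which suffices to transfer acyclicity and the triplexes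
  (\<open>directed_AMP_star\<close>).
\<close>

section \<open>Acyclic directed graphs\<close>

lemma cycle_imp_trancl:
  assumes "cycle G vs"
  shows "(vs ! 0, vs ! 0) \<in> (edges G)\<^sup>+"
proof -
  let ?n = "length vs"
  have n: "?n \<ge> 3"
    and e: "\<And>i. i < ?n \<Longrightarrow> (vs ! i, vs ! (Suc i mod ?n)) \<in> edges G"
    using assms by (auto simp: cycle_def)
  have path: "(vs ! 0, vs ! i) \<in> (edges G)\<^sup>*" if "i < ?n" for i
    using that
  proof (induction i)
    case (Suc i)
    then show ?case
      using e[of i] by (auto intro: rtrancl_into_rtrancl)
  qed simp
  have "(vs ! (?n - 1), vs ! 0) \<in> edges G"
    using e[of "?n - 1"] n by (cases "?n") auto
  moreover have "(vs ! 0, vs ! (?n - 1)) \<in> (edges G)\<^sup>*"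
    using path[of "?n - 1"] n by linarith
  ultimately show ?thesis
    by (rule rtrancl_into_trancl1[rotated])
qed

text \<open>
  Cycles are required to have distinct vertices and length at least three. A shortest closed walk
  has distinct vertices, and in a directed graph it cannot have length one (a loop) or two (a line).
\<close>

lemma acyclic_graph_iff_acyclic:
  assumes "directed_graph G"
  shows "acyclic_graph G \<longleftrightarrow> acyclic (edges G)"
proof
  assume "acyclic (edges G)"
  then show "acyclic_graph G"
    using cycle_imp_trancl unfolding acyclic_graph_def acyclic_def by blast
next
  assume no_cycle: "acyclic_graph G"
  show "acyclic (edges G)"
  proof (rule ccontr)
    let ?closed = "\<lambda>n. 0 < n \<and> (\<exists>x. (x, x) \<in> edges G ^^ n)"
    assume "\<not> acyclic (edges G)"
    then have ex: "\<exists>n. ?closed n"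
      unfolding acyclic_def trancl_power by blast
    define n where "n = (LEAST n. ?closed n)"
    have "?closed n"
      unfolding n_def using ex by (rule LeastI_ex)
    then obtain f where n: "0 < n" and f: "f 0 = f n" "\<And>i. i < n \<Longrightarrow> (f i, f (Suc i)) \<in> edges G"
      unfolding relpow_fun_conv by metis
    have least: "n \<le> m" if "?closed m" for m
      unfolding n_def using that by (rule Least_le)
    have differ: "f i \<noteq> f j" if ij: "i < j" "j < n" for i j
    proof
      assume "f i = f j"
      moreover have "(f i, f j) \<in> edges G ^^ (j - i)"
        unfolding relpow_fun_conv using ij f(2)
        by (intro exI[of _ "\<lambda>k. f (i + k)"]) auto
      ultimately have "?closed (j - i)"
        using ij by auto
      then show False
        using least[of "j - i"] ij by simp
    qed
    have "n \<noteq> 1"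
      using f(1) f(2)[of 0] assms by (auto simp: directed_graph_def mgraph_def irrefl_def)
    moreover have "n \<noteq> 2"
    proof
      assume n2: "n = 2"
      have "(f 0, f 1) \<in> edges G" "(f 1, f 0) \<in> edges G"
        using f(2)[of 0] f(2)[of 1] f(1) n2 by (simp_all add: numeral_2_eq_2)
      then show False
        using assms by (auto simp: directed_graph_def line_def)
    qed
    ultimately have "n \<ge> 3"
      using n by simp
    moreover have "distinct (map f [0..<n])"
      using differ by (auto simp: distinct_conv_nth) (metis linorder_neq_iff)
    moreover have "(f i, f (Suc i mod n)) \<in> edges G" if "i < n" for i
    proof (cases "Suc i = n")
      case True
      then show ?thesis
        using f(1) f(2)[OF that] by simp
    next
      case False
      then show ?thesis
        using f(2)[OF that] that by simp
    qed
    ultimately have "cycle G (map f [0..<n])"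
      by (auto simp: cycle_def)
    then show False
      using no_cycle by (auto simp: acyclic_graph_def)
  qed
qed

lemma ADG_iff_acyclic: "ADG G \<longleftrightarrow> directed_graph G \<and> acyclic (edges G)"
  using acyclic_graph_iff_acyclic by (auto simp: ADG_def)

lemma directed_arrow_iff: "directed_graph G \<Longrightarrow> arrow G a b \<longleftrightarrow> (a, b) \<in> edges G"
  by (auto simp: directed_graph_def arrow_def line_def)

lemma ADG_imp_chain_graph: "ADG G \<Longrightarrow> chain_graph G"
  by (auto simp: ADG_def directed_graph_def chain_graph_def acyclic_graph_def
      semi_directed_cycle_def)

lemma triplexes_directed: "directed_graph G \<Longrightarrow> triplexes G = immoralities G"
  by (auto simp: directed_graph_def triplexes_def immoralities_def)

lemma ADG_equivalence_imp_AMP_equivalence: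
  "(D, D') \<in> ADG_equivalence \<Longrightarrow> (D, D') \<in> AMP_equivalence"
  using ADG_imp_chain_graph triplexes_directed
  unfolding ADG_equivalence_def AMP_equivalence_def ADG_def by fast

section \<open>Protected arrows are never reversed\<close>

lemma triplex_iff:
  "({a, c}, b) \<in> triplexes G \<longleftrightarrow> nonadjacent G a c \<and>
     (arrow G a b \<and> arrow G c b \<or> arrow G a b \<and> line G b c \<or> line G a b \<and> arrow G c b)"
  unfolding triplexes_def mem_Collect_eq prod.inject doubleton_eq_iff line_def nonadjacent_def
  by blast

lemma skeleton_eq_edges:
  "skeleton G = skeleton H \<Longrightarrow>
     (x, y) \<in> edges G \<or> (y, x) \<in> edges G \<longleftrightarrow> (x, y) \<in> edges H \<or> (y, x) \<in> edges H"
  unfolding skeleton_eq_iff by blast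

lemma skeleton_eq_nonadjacent:
  "skeleton G = skeleton H \<Longrightarrow> nonadjacent G x y \<longleftrightarrow> nonadjacent H x y"
  unfolding skeleton_eq_iff nonadjacent_def by blast

lemma chain_graph_no_semi_directed_triangle:
  assumes "chain_graph G" "arrow G x y" "(y, z) \<in> edges G" "(z, x) \<in> edges G"
  shows False
proof -
  have "x \<noteq> y" "y \<noteq> z" "z \<noteq> x"
    using assms by (auto simp: chain_graph_def mgraph_def irrefl_def arrow_def)
  then have "cycle G [x, y, z]"
    using assms by (auto simp: cycle_def arrow_def less_Suc_eq)
  then have "semi_directed_cycle G [x, y, z]"
    using assms(2) by (auto simp: semi_directed_cycle_def intro!: exI[of _ 0])
  then show False
    using assms(1) by (auto simp: chain_graph_def)
qed

text \<open>
  The induction goes along \<open>G\<close> on the head \<open>b\<close> and, for a fixed head, against \<open>G\<close> on the tail \<open>a\<close>.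
  This order is dictated by configuration (iii): there the arrow reversed along with \<open>a \<rightarrow> b\<close> is
  either \<open>a \<rightarrow> c\<close>, with an earlier head, or \<open>c \<rightarrow> b\<close>, with the same head and a later tail.
\<close>

lemma protected_not_reversed:
  assumes G: "ADG G" and prot: "\<And>a b. arrow G a b \<Longrightarrow> protected G a b"
    and H: "chain_graph H" and skel: "skeleton H = skeleton G"
    and tri: "triplexes H = triplexes G"
    and "arrow G a b"
  shows "\<not> arrow H b a"
proof -
  have ac: "acyclic (edges G)" and dir: "directed_graph G"
    using G by (auto simp: ADG_iff_acyclic)
  have "finite (edges G)"
    using dir by (auto simp: directed_graph_def mgraph_def intro: finite_subset)
  then have wf: "wf (edges G)" "wf ((edges G)\<inverse>)"
    using ac by (simp_all add: finite_acyclic_wf finite_acyclic_wf_converse)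
  have noline: "\<not> line G x y" for x y
    using dir by (simp add: directed_graph_def)
  have tri': "({x, z}, y) \<in> triplexes H \<longleftrightarrow> ({x, z}, y) \<in> triplexes G" for x y z
    using tri by simp
  show ?thesis
    using wf(1) \<open>arrow G a b\<close>
  proof (induction b arbitrary: a rule: wf_induct_rule)
    case (less b)
    show ?case
      using wf(2) less.prems
    proof (induction a rule: wf_induct_rule)
      case inner: (less a)
      show ?case
      proof
        assume rev: "arrow H b a"
        have arr: "arrow G a b"
          by (rule inner.prems)
        from prot[OF arr] consider
            (i) c where "arrow G c a" "nonadjacent G c b"
          | (ii) c where "arrow G c b" "nonadjacent G a c"
          | (iii) c where "arrow G a c" "arrow G c b"
          unfolding protected_def by blast
        then show False
        proof cases
          case i
          have "({c, b}, a) \<notin> triplexes G"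
            using arr noline by (auto simp: triplex_iff arrow_def)
          then have "({c, b}, a) \<notin> triplexes H"
            by (simp add: tri')
          moreover have "nonadjacent H c b"
            using i skeleton_eq_nonadjacent[OF skel] by blast
          ultimately have "\<not> arrow H c a" "\<not> line H c a"
            using rev by (auto simp: triplex_iff)
          then have "arrow H a c"
            using i skeleton_eq_edges[OF skel, of a c] by (auto simp: arrow_def line_def)
          moreover have "\<not> arrow H a c"
            using less.IH[of a c] arr i by (simp add: arrow_def)
          ultimately show False by blast
        next
          case ii
          then have "({a, c}, b) \<in> triplexes G"
            using arr by (simp add: triplex_iff)
          then have "({a, c}, b) \<in> triplexes H"
            by (simp add: tri')
          then show False
            using rev by (auto simp: triplex_iff arrow_def line_def)
        next
          case iii
          have "\<not> arrow H c a"
            using less.IH[of c a] iii by (simp add: arrow_def)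
          then have "(a, c) \<in> edges H"
            using iii skeleton_eq_edges[OF skel, of a c] by (auto simp: arrow_def)
          moreover have "\<not> arrow H b c"
            using inner.IH[of c] iii by (simp add: arrow_def)
          then have "(c, b) \<in> edges H"
            using iii skeleton_eq_edges[OF skel, of c b] by (auto simp: arrow_def)
          ultimately show False
            using chain_graph_no_semi_directed_triangle[OF H rev] by blast
        qed
      qed
    qed
  qed
qed

section \<open>Unprotected arrows are reversible\<close>

definition reverse_arrow :: "'a \<Rightarrow> 'a \<Rightarrow> 'a mgraph \<Rightarrow> 'a mgraph" where
  "reverse_arrow a b G = G\<lparr>edges := insert (b, a) (edges G - {(a, b)})\<rparr>"

text \<open>
  An unprotected arrow is what is called a covered arrow. A parent of \<open>a\<close> must be adjacent to \<open>b\<close>,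
  and acyclicity makes it a parent of \<open>b\<close>; a parent of \<open>b\<close> other than \<open>a\<close> must be adjacent to \<open>a\<close>,
  and it is not a child of \<open>a\<close> by the absence of configuration (iii).
\<close>

lemma unprotected_parents:
  assumes "ADG G" "arrow G a b" "\<not> protected G a b"
  shows "(c, b) \<in> edges G \<longleftrightarrow> c = a \<or> (c, a) \<in> edges G"
proof -
  have dir: "directed_graph G" and ac: "acyclic (edges G)"
    using assms by (auto simp: ADG_iff_acyclic)
  have ab: "(a, b) \<in> edges G"
    using assms(2) by (simp add: arrow_def)
  have no2: "(x, y) \<in> edges G \<Longrightarrow> (y, x) \<notin> edges G" for x y
    using dir by (auto simp: directed_graph_def line_def)
  have no3: "(c, a) \<in> edges G \<Longrightarrow> (b, c) \<notin> edges G"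
    using ac ab unfolding acyclic_def by (meson r_into_trancl trancl_into_trancl)
  show ?thesis
    using assms(3) ab no2 no3
    unfolding protected_def directed_arrow_iff[OF dir] nonadjacent_def by blast
qed

text \<open>
  A cycle through the new arrow \<open>b \<rightarrow> a\<close> would return to \<open>b\<close> through a parent other than \<open>a\<close>, which is
  a parent of \<open>a\<close> as well, so it would already yield a cycle in \<open>G\<close>. No immorality at \<open>a\<close> or \<open>b\<close>
  involves the reversed arrow, because the remaining parents of either vertex are adjacent to both.
\<close>

lemma unprotected_reversible:
  assumes "ADG G" "arrow G a b" "\<not> protected G a b"
  shows "(G, reverse_arrow a b G) \<in> ADG_equivalence"
proof -
  let ?G = "reverse_arrow a b G"
  note par = unprotected_parents[OF assms]
  have dir: "directed_graph G" and ac: "acyclic (edges G)"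
    using assms by (auto simp: ADG_iff_acyclic)
  have ab: "(a, b) \<in> edges G"
    using assms(2) by (simp add: arrow_def)
  have irr: "(x, x) \<notin> edges G" for x
    using dir by (auto simp: directed_graph_def mgraph_def irrefl_def)
  have no2: "(x, y) \<in> edges G \<Longrightarrow> (y, x) \<notin> edges G" for x y
    using dir by (auto simp: directed_graph_def line_def)
  have rev: "edges ?G = insert (b, a) (edges G - {(a, b)})" "verts ?G = verts G"
    by (simp_all add: reverse_arrow_def)
  have neq: "a \<noteq> b"
    using ab irr by auto
  have dir': "directed_graph ?G"
    using dir ab neq unfolding directed_graph_def mgraph_def line_def irrefl_def rev by auto
  have skel: "skeleton G = skeleton ?G"
    unfolding skeleton_eq_iff rev using ab by auto
  have "(a, b) \<notin> (edges G - {(a, b)})\<^sup>*"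
  proof
    assume "(a, b) \<in> (edges G - {(a, b)})\<^sup>*"
    then obtain c where c: "(a, c) \<in> (edges G - {(a, b)})\<^sup>*" "(c, b) \<in> edges G" "c \<noteq> a"
      using neq by (auto elim: rtranclE)
    have "(a, c) \<in> (edges G)\<^sup>*"
      using c(1) rtrancl_mono[of "edges G - {(a, b)}" "edges G"] by auto
    moreover have "(c, a) \<in> edges G"
      using c par by blast
    ultimately have "(a, a) \<in> (edges G)\<^sup>+"
      by (rule rtrancl_into_trancl1)
    then show False
      using ac by (auto simp: acyclic_def)
  qed
  moreover have "acyclic (edges G - {(a, b)})"
    using ac by (rule acyclic_subset) auto
  ultimately have "ADG ?G"
    using dir' by (simp add: ADG_iff_acyclic rev acyclic_insert)
  moreover have "immoralities G = immoralities ?G"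
  proof -
    have "nonadjacent G x z \<and> (x, y) \<in> edges G \<and> (z, y) \<in> edges G \<longleftrightarrow>
        nonadjacent ?G x z \<and> (x, y) \<in> edges ?G \<and> (z, y) \<in> edges ?G" for x y z
    proof -
      have nonadj: "nonadjacent ?G x z \<longleftrightarrow> nonadjacent G x z"
        using skeleton_eq_nonadjacent[OF skel] by blast
      consider "y = a" | "y = b" | "y \<noteq> a" "y \<noteq> b" by blast
      then show ?thesis
        unfolding nonadj rev nonadjacent_def using par no2[OF ab] neq by cases auto
    qed
    then show ?thesis
      unfolding immoralities_def directed_arrow_iff[OF dir] directed_arrow_iff[OF dir'] by simp
  qed
  ultimately show ?thesis
    using assms(1) skel by (simp add: ADG_equivalence_def)
qed

lemma arrow_reverse_arrow: "a \<noteq> b \<Longrightarrow> arrow (reverse_arrow a b G) b a"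
  by (simp add: reverse_arrow_def arrow_def)

section \<open>Directed essential graphs\<close>

lemma AMP_class_closed:
  assumes "\<G> \<in> AMP_classes" "G \<in> \<G>" "(G, H) \<in> AMP_equivalence"
  shows "H \<in> \<G>"
  using assms equiv_AMP_equivalence in_quotient_imp_closed unfolding AMP_classes_def by fast

lemma ADG_class_closed:
  assumes "\<D> \<in> ADG_classes" "D \<in> \<D>" "(D, D') \<in> ADG_equivalence"
  shows "D' \<in> \<D>"
  using assms equiv_ADG_equivalence in_quotient_imp_closed unfolding ADG_classes_def by fast

lemma AMP_class_related:
  assumes "\<G> \<in> AMP_classes" "G \<in> \<G>" "H \<in> \<G>"
  shows "(G, H) \<in> AMP_equivalence"
  using assms unfolding AMP_classes_def AMP_equivalence_def by (auto elim!: quotientE)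

lemma AMP_class_nonempty: "\<G> \<in> AMP_classes \<Longrightarrow> \<exists>G. G \<in> \<G>"
  using in_quotient_imp_non_empty[OF equiv_AMP_equivalence] unfolding AMP_classes_def by blast

text \<open>
  Every \<open>G \<in> \<G>\<close> contains each arrow of \<open>\<G>\<^sup>*\<close> as the same arrow or as a line. A cycle of \<open>\<G>\<^sup>*\<close> would
  thus be a cycle in every member, and semi-directed in a member that contains one of its arrows.
  In the same way a triplex of \<open>\<G>\<^sup>*\<close>, which is an immorality, becomes a triplex in a member
  containing one of its two arrows. Conversely, if a member has the flag \<open>x \<rightarrow> y - z\<close>, then \<open>\<G>\<^sup>*\<close>
  cannot contain \<open>y \<rightarrow> z\<close>, since a member with this arrow would lack the triplex.
\<close>

lemma directed_AMP_star:
  assumes cls: "\<G> \<in> AMP_classes" and dir: "directed_graph (AMP_star \<G>)"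
  shows "ADG (AMP_star \<G>)" and "AMP_star \<G> \<in> \<G>"
proof -
  let ?S = "AMP_star \<G>"
  obtain G where G: "G \<in> \<G>"
    using AMP_class_nonempty[OF cls] by blast
  have facts: "chain_graph H" "skeleton ?S = skeleton H" "triplexes H = triplexes G"
    if "H \<in> \<G>" for H
    using AMP_class_related[OF cls that G] skeleton_AMP_star[OF cls that]
    by (auto simp: AMP_equivalence_def)
  have occurs: "\<exists>H\<in>\<G>. arrow H x y" if "(x, y) \<in> edges ?S" for x y
    using that directed_arrow_iff[OF dir] arrow_AMP_star by metis
  have unopposed: "(x, y) \<in> edges H" if "(x, y) \<in> edges ?S" "H \<in> \<G>" for x y H
  proof -
    have "\<not> arrow H y x"
      using that directed_arrow_iff[OF dir] arrow_AMP_star by metis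
    then show ?thesis
      using skeleton_eq_edges[OF facts(2)[OF that(2)], of x y] that(1) by (auto simp: arrow_def)
  qed
  show "ADG ?S"
    unfolding ADG_def acyclic_graph_def
  proof (intro conjI dir notI)
    assume "\<exists>vs. cycle ?S vs"
    then obtain vs where vs: "cycle ?S vs" by blast
    then have "0 < length vs"
      by (auto simp: cycle_def)
    then obtain H where H: "H \<in> \<G>" "arrow H (vs ! 0) (vs ! (Suc 0 mod length vs))"
      using vs occurs unfolding cycle_def by blast
    have "cycle H vs"
      using vs unopposed[OF _ H(1)] by (auto simp: cycle_def)
    then have "semi_directed_cycle H vs"
      using H(2) \<open>0 < length vs\<close> unfolding semi_directed_cycle_def by blast
    then show False
      using facts(1)[OF H(1)] by (auto simp: chain_graph_def)
  qed
  have nonadj: "nonadjacent H x z \<longleftrightarrow> nonadjacent ?S x z" if "H \<in> \<G>" for H x z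
    using skeleton_eq_nonadjacent[OF facts(2)[OF that]] by blast
  have into: "(z, y) \<in> edges ?S"
    if tri: "({x, z}, y) \<in> triplexes G" and adj: "(y, z) \<in> edges ?S \<or> (z, y) \<in> edges ?S" for x y z
  proof (rule ccontr)
    assume "(z, y) \<notin> edges ?S"
    then obtain H where H: "H \<in> \<G>" "arrow H y z"
      using adj occurs by blast
    have "({x, z}, y) \<in> triplexes H"
      using tri facts(3)[OF H(1)] by simp
    then show False
      using H(2) by (auto simp: triplex_iff arrow_def line_def)
  qed
  have "({x, z}, y) \<in> triplexes ?S \<longleftrightarrow> ({x, z}, y) \<in> triplexes G" for x y z
  proof
    assume S: "({x, z}, y) \<in> triplexes ?S"
    then have xy: "(x, y) \<in> edges ?S" and zy: "(z, y) \<in> edges ?S" and na: "nonadjacent ?S x z"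
      by (auto simp: triplex_iff arrow_def line_def)
    obtain H where H: "H \<in> \<G>" "arrow H x y"
      using occurs[OF xy] by blast
    have "arrow H z y \<or> line H y z"
      using unopposed[OF zy H(1)] by (auto simp: arrow_def line_def)
    then have "({x, z}, y) \<in> triplexes H"
      using H na nonadj by (auto simp: triplex_iff)
    then show "({x, z}, y) \<in> triplexes G"
      using facts(3)[OF H(1)] by simp
  next
    assume T: "({x, z}, y) \<in> triplexes G"
    then have T': "({z, x}, y) \<in> triplexes G"
      by (simp add: insert_commute)
    have "(y, z) \<in> edges ?S \<or> (z, y) \<in> edges ?S" "(y, x) \<in> edges ?S \<or> (x, y) \<in> edges ?S"
      using T skeleton_eq_edges[OF facts(2)[OF G], of y z]
        skeleton_eq_edges[OF facts(2)[OF G], of y x]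
      by (auto simp: triplex_iff arrow_def line_def)
    then have "(z, y) \<in> edges ?S" "(x, y) \<in> edges ?S"
      using into T T' by blast+
    moreover have "nonadjacent ?S x z"
      using T nonadj[OF G] by (auto simp: triplex_iff)
    ultimately show "({x, z}, y) \<in> triplexes ?S"
      by (simp add: triplex_iff directed_arrow_iff[OF dir])
  qed
  then have "triplexes ?S = triplexes G"
    unfolding set_eq_iff by (auto simp: triplexes_def; metis)
  then have "(G, ?S) \<in> AMP_equivalence"
    using facts(1,2)[OF G] ADG_imp_chain_graph[OF \<open>ADG ?S\<close>] by (simp add: AMP_equivalence_def)
  then show "?S \<in> \<G>"
    by (rule AMP_class_closed[OF cls G])
qed

text \<open>
  The reversal of an unprotected arrow is an equivalent ADG, hence also an AMP equivalent chain
  graph; it lies in the class of \<open>G\<close> and would turn this arrow of the essential graph into a line.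
\<close>

lemma AMP_essential_directed_iff:
  assumes dir: "directed_graph G"
  shows "AMP_essential_graph G \<longleftrightarrow>
    acyclic_graph G \<and> (\<forall>a b. arrow G a b \<longrightarrow> protected G a b)"
proof
  assume "AMP_essential_graph G"
  then obtain \<G> where cls: "\<G> \<in> AMP_classes" and G: "G = AMP_star \<G>"
    by (auto simp: AMP_essential_graph_def)
  have ADG: "ADG G" and mem: "G \<in> \<G>"
    using directed_AMP_star[OF cls] dir G by auto
  have "protected G a b" if ab: "arrow G a b" for a b
  proof (rule ccontr)
    assume "\<not> protected G a b"
    then have "(G, reverse_arrow a b G) \<in> AMP_equivalence"
      using unprotected_reversible[OF ADG ab] ADG_equivalence_imp_AMP_equivalence by blast
    then have "reverse_arrow a b G \<in> \<G>"
      by (rule AMP_class_closed[OF cls mem])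
    moreover have "arrow (reverse_arrow a b G) b a"
      using ab by (intro arrow_reverse_arrow) (auto simp: arrow_def)
    ultimately show False
      using ab unfolding G arrow_AMP_star by blast
  qed
  then show "acyclic_graph G \<and> (\<forall>a b. arrow G a b \<longrightarrow> protected G a b)"
    using ADG by (simp add: ADG_def)
next
  assume r: "acyclic_graph G \<and> (\<forall>a b. arrow G a b \<longrightarrow> protected G a b)"
  then have ADG: "ADG G"
    using dir by (simp add: ADG_def)
  let ?\<G> = "AMP_equivalence `` {G}"
  have cls: "?\<G> \<in> AMP_classes"
    using ADG_imp_chain_graph[OF ADG] by (auto simp: AMP_classes_def quotient_def)
  have mem: "G \<in> ?\<G>"
    using ADG_imp_chain_graph[OF ADG] by (simp add: AMP_equivalence_def)
  have "\<not> arrow H b a" if "arrow G a b" "H \<in> ?\<G>" for H a b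
    using that r protected_not_reversed[OF ADG, of H a b] by (auto simp: AMP_equivalence_def)
  then have arr: "arrow (AMP_star ?\<G>) a b" if "(a, b) \<in> edges G" for a b
    using that mem unfolding arrow_AMP_star directed_arrow_iff[OF dir, symmetric] by blast
  have skel: "skeleton (AMP_star ?\<G>) = skeleton G"
    by (rule skeleton_AMP_star[OF cls mem])
  have "(a, b) \<in> edges (AMP_star ?\<G>) \<longleftrightarrow> (a, b) \<in> edges G" for a b
    using arr[of a b] arr[of b a] skeleton_eq_edges[OF skel, of a b] by (auto simp: arrow_def)
  then have "edges (AMP_star ?\<G>) = edges G"
    by auto
  moreover have "verts (AMP_star ?\<G>) = verts G"
    using skel by (simp add: skeleton_eq_iff)
  ultimately show "AMP_essential_graph G"
    unfolding AMP_essential_graph_def by (intro bexI[OF _ cls]) simp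
qed

lemma directed_ADG_star:
  assumes cls: "\<D> \<in> ADG_classes" and dir: "directed_graph (ADG_star \<D>)" and D: "D \<in> \<D>"
  shows "ADG_star \<D> = D"
proof -
  have skel: "skeleton (ADG_star \<D>) = skeleton D"
    by (rule skeleton_ADG_star[OF cls D])
  have "(a, b) \<in> edges (ADG_star \<D>) \<longleftrightarrow> (a, b) \<in> edges D" for a b
    using D arrow_ADG_star[OF cls, of a b] directed_arrow_iff[OF dir, of a b]
    by (auto simp: arrow_def ADG_star_def)
  then have "edges (ADG_star \<D>) = edges D"
    by auto
  moreover have "verts (ADG_star \<D>) = verts D"
    using skel by (simp add: skeleton_eq_iff)
  ultimately show ?thesis by simp
qed

lemma ADG_essential_directed_iff:
  assumes dir: "directed_graph G"
  shows "ADG_essential_graph G \<longleftrightarrow>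
    acyclic_graph G \<and> (\<forall>a b. arrow G a b \<longrightarrow> protected G a b)"
proof
  assume "ADG_essential_graph G"
  then obtain \<D> where cls: "\<D> \<in> ADG_classes" and G: "G = ADG_star \<D>"
    by (auto simp: ADG_essential_graph_def)
  have only: "D = G" if "D \<in> \<D>" for D
    using directed_ADG_star[OF cls _ that] dir G by simp
  then have mem: "G \<in> \<D>"
    using ADG_class_facts(1)[OF cls] by auto
  then have ADG: "ADG G"
    using cls unfolding ADG_classes_def ADG_equivalence_def by (auto elim!: quotientE)
  have "protected G a b" if ab: "arrow G a b" for a b
  proof (rule ccontr)
    assume "\<not> protected G a b"
    then have "reverse_arrow a b G \<in> \<D>"
      using unprotected_reversible[OF ADG ab] by (intro ADG_class_closed[OF cls mem])
    then have "reverse_arrow a b G = G"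
      by (rule only)
    moreover have "arrow (reverse_arrow a b G) b a"
      using ab by (intro arrow_reverse_arrow) (auto simp: arrow_def)
    ultimately have "arrow G b a"
      by simp
    then show False
      using ab by (simp add: arrow_def)
  qed
  then show "acyclic_graph G \<and> (\<forall>a b. arrow G a b \<longrightarrow> protected G a b)"
    using ADG by (simp add: ADG_def)
next
  assume r: "acyclic_graph G \<and> (\<forall>a b. arrow G a b \<longrightarrow> protected G a b)"
  then have ADG: "ADG G"
    using dir by (simp add: ADG_def)
  let ?\<D> = "ADG_equivalence `` {G}"
  have cls: "?\<D> \<in> ADG_classes"
    using ADG by (auto simp: ADG_classes_def quotient_def)
  have mem: "G \<in> ?\<D>"
    using ADG by (simp add: ADG_equivalence_def)
  have "(a, b) \<in> edges G" if ab: "(a, b) \<in> edges D" and D: "D \<in> ?\<D>" for D a b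
  proof (rule ccontr)
    assume "(a, b) \<notin> edges G"
    then have ba: "arrow G b a" and "arrow D a b"
      using ADG_class_edges[OF cls D mem ab] ADG_class_facts(2)[OF cls D] ab
      by (auto simp: arrow_def line_def)
    moreover have "(G, D) \<in> AMP_equivalence"
      using D ADG_equivalence_imp_AMP_equivalence by blast
    ultimately show False
      using r protected_not_reversed[OF ADG, of D b a] by (auto simp: AMP_equivalence_def)
  qed
  then have "edges (ADG_star ?\<D>) = edges G"
    using mem by (auto simp: ADG_star_def)
  moreover have "verts (ADG_star ?\<D>) = verts G"
    using skeleton_ADG_star[OF cls mem] by (simp add: skeleton_eq_iff)
  ultimately show "ADG_essential_graph G"
    unfolding ADG_essential_graph_def by (intro bexI[OF _ cls]) simp
qed

theorem theorem4p1:
  "(\<forall>G :: 'a mgraph. directed_graph G \<longrightarrow>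
      (AMP_essential_graph G \<longleftrightarrow>
        acyclic_graph G \<and> (\<forall>a b. arrow G a b \<longrightarrow> protected G a b))) \<and>
   {G :: 'a mgraph. directed_graph G \<and> AMP_essential_graph G} =
   {G :: 'a mgraph. directed_graph G \<and> ADG_essential_graph G}"
  using AMP_essential_directed_iff ADG_essential_directed_iff by blast

end
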